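(* Let $S$ be the subsemigroup of $\mathcal{T}(\mathbb{Z})$ generated by the transformations $x: i\mapsto i+1$, $x^{-1}: i\mapsto i-1$ and the constant transformations $\tau_j: i\mapsto j$ for each $j\in\mathbb{Z}$. Then $S$ is a completely regular semigroup with context-free word problem, but $S$ cannot be expressed as a union of finitely many finitely generated groups.
   Context: $\mathcal{T}(X)$ denotes the left transformation semigroup of a set $X$: the semigroup of all maps $X\to X$ acting on the left, under composition. A semigroup is completely regular if it can be expressed as a disjoint union of groups (subsemigroups that are groups under the induced operation). In the last assertion, "groups" likewise means subsemigroups of $S$ that are groups. For a semigroup $S$ and a finite generating set $A$ of $S$ (as a semigroup), the (unfolded) word problem of $S$ with respect to $A$ is the language $$\mathrm{WP}(S,A) = \{\, u\#v^{\mathrm{rev}} : u,v\in A^+,\ u =_S v \,\}$$ over the alphabet $A\cup\{\#\}$, where $v^{\mathrm{rev}}$ is the reverse of the word $v$, $\#$ is a new symbol not in $A$, and $u=_S v$ means that $u$ and $v$ represent the same element of $S$. $S$ has context-free word problem if $\mathrm{WP}(S,A)$ is a context-free language for some finite generating set $A$ of $S$; this property does not depend on the choice of finite generating set. *)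

theory Defs
  imports "HOL-Algebra.Generated_Groups"
begin

datatype ('n, 't) symbol = Nt 'n | Tm 't

inductive derive_step ::
    "('n \<times> ('n, 't) symbol list) set \<Rightarrow> ('n, 't) symbol list \<Rightarrow> ('n, 't) symbol list \<Rightarrow> bool"
  for P where
  "(X, w) \<in> P \<Longrightarrow> derive_step P (u @ [Nt X] @ v) (u @ w @ v)"

definition grammar_language :: "('n \<times> ('n, 't) symbol list) set \<Rightarrow> 'n \<Rightarrow> 't list set" where
  "grammar_language P X = {w. (derive_step P)\<^sup>*\<^sup>* [Nt X] (map Tm w)}"

text \<open>A finite set of productions mentions only finitely many nonterminals, so taking
  nonterminals to be natural numbers loses no generality.\<close>

definition context_free :: "'t list set \<Rightarrow> bool" where
  "context_free L \<longleftrightarrow>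
     (\<exists>(P :: (nat \<times> (nat, 't) symbol list) set) X. finite P \<and> L = grammar_language P X)"

text \<open>A semigroup is given by a carrier set \<open>S\<close> and an operation \<open>f\<close>. HOL-Algebra has no
  semigroups without identity.\<close>

definition semigroup_on :: "('a \<Rightarrow> 'a \<Rightarrow> 'a) \<Rightarrow> 'a set \<Rightarrow> bool" where
  "semigroup_on f S \<longleftrightarrow>
     (\<forall>a\<in>S. \<forall>b\<in>S. f a b \<in> S) \<and>
     (\<forall>a\<in>S. \<forall>b\<in>S. \<forall>c\<in>S. f (f a b) c = f a (f b c))"

inductive_set subsemigroup_generated :: "('a \<Rightarrow> 'a \<Rightarrow> 'a) \<Rightarrow> 'a set \<Rightarrow> 'a set"
  for f A where
  incl: "a \<in> A \<Longrightarrow> a \<in> subsemigroup_generated f A"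
| mult: "a \<in> subsemigroup_generated f A \<Longrightarrow> b \<in> subsemigroup_generated f A
         \<Longrightarrow> f a b \<in> subsemigroup_generated f A"

text \<open>A subsemigroup that is a group has its own identity \<open>e\<close>, which need not be an identity
  of the ambient semigroup.\<close>

abbreviation group_structure :: "('a \<Rightarrow> 'a \<Rightarrow> 'a) \<Rightarrow> 'a set \<Rightarrow> 'a \<Rightarrow> 'a monoid" where
  "group_structure f G e \<equiv> \<lparr>carrier = G, mult = f, one = e\<rparr>"

definition group_in_semigroup :: "('a \<Rightarrow> 'a \<Rightarrow> 'a) \<Rightarrow> 'a set \<Rightarrow> 'a set \<Rightarrow> bool" where
  "group_in_semigroup f S G \<longleftrightarrow> G \<subseteq> S \<and> (\<exists>e. group (group_structure f G e))"

definition fin_gen_group_in_semigroup :: "('a \<Rightarrow> 'a \<Rightarrow> 'a) \<Rightarrow> 'a set \<Rightarrow> 'a set \<Rightarrow> bool" where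
  "fin_gen_group_in_semigroup f S G \<longleftrightarrow>
     G \<subseteq> S \<and>
     (\<exists>e. group (group_structure f G e) \<and>
          (\<exists>X. finite X \<and> X \<subseteq> G \<and> generate (group_structure f G e) X = G))"

definition completely_regular :: "('a \<Rightarrow> 'a \<Rightarrow> 'a) \<Rightarrow> 'a set \<Rightarrow> bool" where
  "completely_regular f S \<longleftrightarrow>
     semigroup_on f S \<and>
     (\<exists>\<G>. (\<forall>G\<in>\<G>. group_in_semigroup f S G) \<and> pairwise disjnt \<G> \<and> \<Union>\<G> = S)"

text \<open>The clause for the empty word is arbitrary: only nonempty words are ever evaluated.\<close>

fun word_value :: "('a \<Rightarrow> 'a \<Rightarrow> 'a) \<Rightarrow> 'a list \<Rightarrow> 'a" where
  "word_value f [] = undefined"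
| "word_value f [a] = a"
| "word_value f (a # b # w) = f a (word_value f (b # w))"

text \<open>Over the alphabet \<open>A \<union> {#}\<close>, a letter \<open>a\<close> of \<open>A\<close> is \<open>Some a\<close> and the new symbol \<open>#\<close>
  is \<open>None\<close>.\<close>

definition word_problem :: "('a \<Rightarrow> 'a \<Rightarrow> 'a) \<Rightarrow> 'a set \<Rightarrow> 'a option list set" where
  "word_problem f A =
     {map Some u @ [None] @ map Some (rev v) | u v.
        u \<in> lists A \<and> u \<noteq> [] \<and> v \<in> lists A \<and> v \<noteq> [] \<and> word_value f u = word_value f v}"

definition has_context_free_word_problem :: "('a \<Rightarrow> 'a \<Rightarrow> 'a) \<Rightarrow> 'a set \<Rightarrow> bool" where
  "has_context_free_word_problem f S \<longleftrightarrow>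
     (\<exists>A. finite A \<and> subsemigroup_generated f A = S \<and> context_free (word_problem f A))"

text \<open>Maps act on the left, so the product of \<open>f\<close> and \<open>g\<close> is \<open>f \<circ> g\<close>.\<close>

definition shift_const_semigroup :: "(int \<Rightarrow> int) set" where
  "shift_const_semigroup =
     subsemigroup_generated (\<circ>) ({(\<lambda>i. i + 1), (\<lambda>i. i - 1)} \<union> {(\<lambda>i. j) | j. True})"

end

theory Submission
  imports Defs
begin

text \<open>The semigroup consists of the shifts \<open>i \<mapsto> i + k\<close> and the constants; the shifts form a group
  and each constant is a group on its own. Over the generators \<open>x\<close>, \<open>x\<inverse>\<close>, \<open>\<tau>\<^sub>0\<close>, a word without
  \<open>\<tau>\<^sub>0\<close> is the shift by its exponent sum, and every other word is the constant given by the exponent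
  sum of the part before the first \<open>\<tau>\<^sub>0\<close>. So both sides of the word problem only compare two exponent
  sums, which a grammar does by splitting a word of sum \<open>k\<close> into \<open>k\<close> letters of the same sign
  separated by words of sum \<open>0\<close>. Finally, a subgroup that contains a constant is a singleton, so
  infinitely many subgroups are needed to cover the constants.\<close>

section \<open>Languages of grammars as least solutions\<close>

text \<open>The assignment \<open>L\<close> of languages to nonterminals is extended to sentential
  forms by concatenation. A grammar then becomes a system of inclusions, one for each
  production.\<close>

fun form_language :: "('n \<Rightarrow> 't list set) \<Rightarrow> ('n, 't) symbol list \<Rightarrow> 't list set" where
  "form_language L [] = {[]}"
| "form_language L (Nt X # \<alpha>) = {u @ v | u v. u \<in> L X \<and> v \<in> form_language L \<alpha>}"
| "form_language L (Tm a # \<alpha>) = {a # v | v. v \<in> form_language L \<alpha>}"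

lemma form_language_intros:
  "[] \<in> form_language L []"
  "u \<in> L X \<Longrightarrow> u \<in> form_language L [Nt X]"
  "u \<in> L X \<Longrightarrow> v \<in> form_language L \<alpha> \<Longrightarrow> u @ v \<in> form_language L (Nt X # \<alpha>)"
  "v \<in> form_language L \<alpha> \<Longrightarrow> a # v \<in> form_language L (Tm a # \<alpha>)"
  by auto

lemma form_language_append:
  "form_language L (\<alpha> @ \<beta>) = {u @ v | u v. u \<in> form_language L \<alpha> \<and> v \<in> form_language L \<beta>}"
proof (induction L \<alpha> rule: form_language.induct)
  case (2 L X \<alpha>)
  show ?case
  proof (intro equalityI subsetI)
    fix w assume "w \<in> form_language L ((Nt X # \<alpha>) @ \<beta>)"
    then obtain u v v' where "w = (u @ v) @ v'" "u \<in> L X" "v \<in> form_language L \<alpha>"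
      "v' \<in> form_language L \<beta>"
      by (auto simp: 2)
    then show "w \<in> {u @ v | u v. u \<in> form_language L (Nt X # \<alpha>) \<and> v \<in> form_language L \<beta>}"
      by (simp only: form_language.simps) blast
  next
    fix w assume "w \<in> {u @ v | u v. u \<in> form_language L (Nt X # \<alpha>) \<and> v \<in> form_language L \<beta>}"
    then obtain u v v' where "w = u @ (v @ v')" "u \<in> L X" "v \<in> form_language L \<alpha>"
      "v' \<in> form_language L \<beta>"
      by auto
    then show "w \<in> form_language L ((Nt X # \<alpha>) @ \<beta>)"
      by (simp only: 2 form_language.simps append_Cons) blast
  qed
next
  case (3 L a \<alpha>)
  then show ?case by (auto simp: 3) (metis append_Cons)+
qed simp

lemma form_language_map_Tm: "form_language L (map Tm w) = {w}"
  by (induction w) auto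

text \<open>A derivation step replaces \<open>Nt Y\<close>, read as \<open>L Y\<close>, by a form
  that denotes a subset of \<open>L Y\<close>, so languages only shrink along a derivation, and a
  terminal word denotes just itself. This bounds a grammar's language from above by a guessed
  solution.\<close>

lemma grammar_language_least:
  assumes closed: "\<And>X \<alpha>. (X, \<alpha>) \<in> P \<Longrightarrow> form_language L \<alpha> \<subseteq> L X"
  shows "grammar_language P X \<subseteq> L X"
proof
  have derive_subset: "form_language L \<beta> \<subseteq> form_language L \<alpha>" if "derive_step P \<alpha> \<beta>" for \<alpha> \<beta>
    using that
  proof cases
    case (1 Y w u v)
    then show ?thesis
      using closed[of Y w] by (auto simp: form_language_append) blast
  qed
  have steps: "form_language L \<beta> \<subseteq> form_language L \<alpha>" if "(derive_step P)\<^sup>*\<^sup>* \<alpha> \<beta>" for \<alpha> \<beta>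
    using that
  proof induction
    case (step \<beta> \<gamma>)
    then show ?case by (meson derive_subset subset_trans)
  qed simp
  fix w assume "w \<in> grammar_language P X"
  then have "(derive_step P)\<^sup>*\<^sup>* [Nt X] (map Tm w)"
    by (simp add: grammar_language_def)
  then have "form_language L (map Tm w) \<subseteq> form_language L [Nt X]"
    by (rule steps)
  then show "w \<in> L X"
    by (simp add: form_language_map_Tm)
qed

section \<open>Derivations in context; the languages of the nonterminals form a solution\<close>

lemma derive_step_context:
  assumes "derive_step P \<alpha> \<beta>"
  shows "derive_step P (\<gamma> @ \<alpha> @ \<delta>) (\<gamma> @ \<beta> @ \<delta>)"
  using assms
proof cases
  case (1 X w u v)
  then show ?thesis
    using derive_step.intros[of X w P "\<gamma> @ u" "v @ \<delta>"] by simp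
qed

lemma derive_steps_context:
  assumes "(derive_step P)\<^sup>*\<^sup>* \<alpha> \<beta>"
  shows "(derive_step P)\<^sup>*\<^sup>* (\<gamma> @ \<alpha> @ \<delta>) (\<gamma> @ \<beta> @ \<delta>)"
  using assms
proof induction
  case (step \<beta> \<beta>')
  then show ?case by (meson derive_step_context rtranclp.rtrancl_into_rtrancl)
qed simp

lemma derive_steps_form_language:
  "w \<in> form_language (grammar_language P) \<alpha> \<Longrightarrow> (derive_step P)\<^sup>*\<^sup>* \<alpha> (map Tm w)"
proof (induction \<alpha> arbitrary: w)
  case (Cons s \<alpha>)
  show ?case
  proof (cases s)
    case (Nt X)
    with Cons.prems obtain u v where w: "w = u @ v" and u: "(derive_step P)\<^sup>*\<^sup>* [Nt X] (map Tm u)"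
      and v: "v \<in> form_language (grammar_language P) \<alpha>"
      by (fastforce simp: grammar_language_def[of P X])
    have "(derive_step P)\<^sup>*\<^sup>* (s # \<alpha>) (map Tm u @ \<alpha>)"
      using derive_steps_context[OF u, of "[]" \<alpha>] Nt by simp
    also have "(derive_step P)\<^sup>*\<^sup>* \<dots> (map Tm w)"
      using derive_steps_context[OF Cons.IH[OF v], of "map Tm u" "[]"] w by simp
    finally show ?thesis .
  next
    case (Tm a)
    with Cons.prems obtain v where w: "w = a # v" and v: "v \<in> form_language (grammar_language P) \<alpha>"
      by auto
    show ?thesis
      using derive_steps_context[OF Cons.IH[OF v], of "[Tm a]" "[]"] w Tm by simp
  qed
qed simp

text \<open>A production is applied first, then each nonterminal of its right-hand side is derived
  in place. All later membership proofs for the grammar go through this rule instead of explicit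
  derivations.\<close>

lemma grammar_language_closed:
  assumes "(X, \<alpha>) \<in> P" "w \<in> form_language (grammar_language P) \<alpha>"
  shows "w \<in> grammar_language P X"
proof -
  have "derive_step P [Nt X] \<alpha>"
    using derive_step.intros[OF assms(1), of "[]" "[]"] by simp
  then show ?thesis
    using derive_steps_form_language[OF assms(2)]
    by (simp add: grammar_language_def converse_rtranclp_into_rtranclp)
qed

section \<open>Comparing exponent sums around a marker\<close>

text \<open>The exponent sum, with \<open>p\<close> in the role of x and \<open>m\<close> in that of
  its inverse.\<close>

definition balance :: "'t \<Rightarrow> 't \<Rightarrow> 't list \<Rightarrow> int" where
  "balance p m w = int (count_list w p) - int (count_list w m)"

lemma balance_simps [simp]:
  "balance p m [] = 0"
  "balance p m (u @ v) = balance p m u + balance p m v"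
  "balance p m (rev u) = balance p m u"
  "p \<noteq> m \<Longrightarrow> balance p m (p # u) = balance p m u + 1"
  "p \<noteq> m \<Longrightarrow> balance p m (m # u) = balance p m u - 1"
  "p \<noteq> a \<Longrightarrow> m \<noteq> a \<Longrightarrow> balance p m (a # u) = balance p m u"
  by (auto simp: balance_def)

text \<open>Isolates the contribution of a letter \<open>a\<close> known only to be \<open>p\<close>
  or \<open>m\<close>, so that it cancels when \<open>a\<close> occurs on both sides of an
  equation.\<close>

lemma balance_Cons: "balance p m (a # w) = balance p m [a] + balance p m w"
  using balance_simps(2)[of p m "[a]" w] by simp

lemma balance_swap: "balance m p w = - balance p m w"
  by (simp add: balance_def)

lemma balance_map_inj:
  assumes "inj f"
  shows "balance (f p) (f m) (map f w) = balance p m w"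
  by (induction w) (use assms in \<open>auto simp: balance_def inj_eq\<close>)

definition zero_words :: "'t \<Rightarrow> 't \<Rightarrow> 't list set" where
  "zero_words p m = {w \<in> lists {p, m}. balance p m w = 0}"

text \<open>The middle factor is a parameter: \<open>{[h]}\<close> serves pairs of shifts,
  \<open>zero_marker\<close> pairs of constants.\<close>

definition equal_balance_around :: "'t \<Rightarrow> 't \<Rightarrow> 't list set \<Rightarrow> 't list set" where
  "equal_balance_around p m M =
     {u @ z @ v | u z v. u \<in> lists {p, m} \<and> v \<in> lists {p, m} \<and> z \<in> M \<and> balance p m u = balance p m v}"

text \<open>The letter \<open>p\<close> in the middle is the one with which the partial sums first become positive.\<close>

lemma split_positive_balance:
  assumes "p \<noteq> m" "w \<in> lists {p, m}" "balance p m w > 0"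
  obtains d w' where "w = d @ [p] @ w'" "d \<in> zero_words p m" "w' \<in> lists {p, m}"
proof -
  have "\<exists>d w'. w = d @ [p] @ w' \<and> d \<in> zero_words p m \<and> w' \<in> lists {p, m}"
    using assms(2,3)
  proof (induction w rule: length_induct)
    case (1 w)
    note IH = 1(1)[rule_format] and w = 1(2,3)
    show ?case
    proof (cases w)
      case Nil
      with w show ?thesis by simp
    next
      case (Cons a u)
      show ?thesis
      proof (cases "a = p")
        case True
        then show ?thesis
          using Cons w by (intro exI[of _ "[]"] exI[of _ u]) (auto simp: zero_words_def)
      next
        case False
        \<comment> \<open>The induction hypothesis is used twice: the first \<open>p\<close> found
          cancels the leading \<open>m\<close>, so the rest \<open>v\<close> has the balance of
          \<open>w\<close>, still positive, and yields the \<open>p\<close> that is wanted.\<close>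
        with Cons w have a: "a = m" and u: "u \<in> lists {p, m}" by auto
        with Cons w assms(1) have "balance p m u > 0" "length u < length w" by auto
        with IH[OF _ u] obtain d v
          where d: "u = d @ [p] @ v" "d \<in> zero_words p m" "v \<in> lists {p, m}"
          by blast
        with a Cons w(2) assms(1) have "balance p m v > 0" "length v < length w"
          by (auto simp: zero_words_def)
        with IH[OF _ d(3)] obtain e v'
          where e: "v = e @ [p] @ v'" "e \<in> zero_words p m" "v' \<in> lists {p, m}"
          by blast
        have "m # d @ [p] @ e \<in> zero_words p m"
          using d(2) e(2) assms(1) by (auto simp: zero_words_def)
        moreover have "w = (m # d @ [p] @ e) @ [p] @ v'"
          using Cons a d(1) e(1) by simp
        ultimately show ?thesis using e(3) by blast
      qed
    qed
  qed
  then show ?thesis using that by blast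
qed

lemma split_positive_balance_rev:
  assumes "p \<noteq> m" "w \<in> lists {p, m}" "balance p m w > 0"
  obtains d w' where "w = w' @ [p] @ d" "d \<in> zero_words p m" "w' \<in> lists {p, m}"
proof -
  obtain d w' where "rev w = d @ [p] @ w'" "d \<in> zero_words p m" "w' \<in> lists {p, m}"
    using split_positive_balance[of p m "rev w"] assms by (auto simp: in_lists_conv_set)
  then show ?thesis
    using that[of "rev w'" "rev d"] by (auto simp: zero_words_def in_lists_conv_set rev_swap)
qed

lemma zero_words_swap: "zero_words m p = zero_words p m"
  by (auto simp: zero_words_def balance_swap[of m p] insert_commute)

text \<open>The sign of the common balance decides the letter \<open>a\<close>. It is taken from the
  left of \<open>u\<close> and from the right of \<open>v\<close>, which is the shape of the
  productions \<open>[Nt 1, Tm a, Nt X, Tm a, Nt 1]\<close>. The negative case is the positive one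
  with \<open>p\<close> and \<open>m\<close> exchanged.\<close>

lemma split_equal_balance:
  assumes "p \<noteq> m" "u \<in> lists {p, m}" "v \<in> lists {p, m}"
    and eq: "balance p m u = balance p m v" and nonzero: "balance p m u \<noteq> 0"
  obtains a d u' v' e where "a = p \<or> a = m" "u = d @ [a] @ u'" "v = v' @ [a] @ e"
    "d \<in> zero_words p m" "e \<in> zero_words p m" "u' \<in> lists {p, m}" "v' \<in> lists {p, m}"
    "balance p m u' = balance p m v'"
proof (cases "balance p m u > 0")
  case True
  then have pos: "balance p m v > 0" using eq by simp
  obtain d u' where u: "u = d @ [p] @ u'" "d \<in> zero_words p m" "u' \<in> lists {p, m}"
    using split_positive_balance[OF assms(1,2) True] .
  obtain e v' where v: "v = v' @ [p] @ e" "e \<in> zero_words p m" "v' \<in> lists {p, m}"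
    using split_positive_balance_rev[OF assms(1,3) pos] .
  have "balance p m u' = balance p m v'"
    using u v eq assms(1) by (simp add: zero_words_def)
  then show ?thesis using that[of p d u' v' e] u v by simp
next
  case False
  then have pos: "balance m p u > 0" "balance m p v > 0"
    using eq nonzero by (simp_all add: balance_swap[of m p])
  have swap: "m \<noteq> p" "{m, p} = {p, m}" using assms(1) by auto
  obtain d u' where u: "u = d @ [m] @ u'" "d \<in> zero_words p m" "u' \<in> lists {p, m}"
    using split_positive_balance[of m p u] assms(2) pos(1) unfolding swap(2) zero_words_swap[of m p]
    by (metis swap(1))
  obtain e v' where v: "v = v' @ [m] @ e" "e \<in> zero_words p m" "v' \<in> lists {p, m}"
    using split_positive_balance_rev[of m p v] assms(3) pos(2)
    unfolding swap(2) zero_words_swap[of m p] by (metis swap(1))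
  have "balance p m u' = balance p m v'"
    using u v eq assms(1) by (simp add: zero_words_def)
  then show ?thesis using that[of m d u' v' e] u v by simp
qed

text \<open>After the first letter the rest has balance 1 in favour of the opposite letter, so it
  splits at an occurrence of that letter into two words of balance 0. The two induction steps mirror
  the productions of nonterminal 5.\<close>

lemma zero_words_induct [consumes 2, case_names Nil pos neg]:
  assumes "w \<in> zero_words p m" "p \<noteq> m"
    and Nil: "Q []"
    and pos: "\<And>u v. \<lbrakk>u \<in> zero_words p m; v \<in> zero_words p m; Q u; Q v\<rbrakk> \<Longrightarrow> Q (p # u @ m # v)"
    and neg: "\<And>u v. \<lbrakk>u \<in> zero_words p m; v \<in> zero_words p m; Q u; Q v\<rbrakk> \<Longrightarrow> Q (m # u @ p # v)"
  shows "Q w"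
  using assms(1)
proof (induction w rule: length_induct)
  case (1 w)
  show ?case
  proof (cases w)
    case (Cons a u)
    with 1 have u: "u \<in> lists {p, m}" and "a = p \<or> a = m" by (auto simp: zero_words_def)
    from this(2) show ?thesis
    proof
      assume a: "a = p"
      with Cons 1 assms(2) have "balance m p u > 0"
        by (simp add: zero_words_def balance_swap[of m p])
      then obtain d v where d: "u = d @ [m] @ v" "d \<in> zero_words p m" "v \<in> lists {p, m}"
        using split_positive_balance[of m p u] u assms(2) by (metis insert_commute zero_words_swap)
      then have "v \<in> zero_words p m" using Cons 1 a assms(2) by (auto simp: zero_words_def)
      then show ?thesis using pos[of d v] d Cons 1 a by simp
    next
      assume a: "a = m"
      with Cons 1 assms(2) have "balance p m u > 0"
        by (simp add: zero_words_def)
      then obtain d v where d: "u = d @ [p] @ v" "d \<in> zero_words p m" "v \<in> lists {p, m}"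
        using split_positive_balance[of p m u] u assms(2) by metis
      then have "v \<in> zero_words p m" using Cons 1 a assms(2) by (auto simp: zero_words_def)
      then show ?thesis using neg[of d v] d Cons 1 a by simp
    qed
  qed (simp add: Nil)
qed

lemma equal_balance_aroundI:
  assumes "u \<in> lists {p, m}" "v \<in> lists {p, m}" "z \<in> M" "balance p m u = balance p m v"
  shows "u @ z @ v \<in> equal_balance_around p m M"
  using assms unfolding equal_balance_around_def by blast

text \<open>Either both sides have balance 0, or an equal pair of letters can be peeled off, leaving
  a shorter word \<open>y\<close> of the same language.\<close>

lemma equal_balance_around_cases:
  assumes "w \<in> equal_balance_around p m M" "p \<noteq> m"
  obtains (zero) d z e where "w = d @ z @ e" "d \<in> zero_words p m" "e \<in> zero_words p m" "z \<in> M"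
  | (letter) a d y e where "w = d @ [a] @ y @ [a] @ e" "a = p \<or> a = m"
      "d \<in> zero_words p m" "e \<in> zero_words p m" "y \<in> equal_balance_around p m M"
proof -
  from assms(1) obtain u z v where w: "w = u @ z @ v" "u \<in> lists {p, m}" "v \<in> lists {p, m}"
    "z \<in> M" and eq: "balance p m u = balance p m v"
    unfolding equal_balance_around_def by blast
  show ?thesis
  proof (cases "balance p m u = 0")
    case True
    then show ?thesis using w eq by (intro zero[of u z v]) (auto simp: zero_words_def)
  next
    case False
    obtain a d u' v' e where s: "a = p \<or> a = m" "u = d @ [a] @ u'" "v = v' @ [a] @ e"
      "d \<in> zero_words p m" "e \<in> zero_words p m" "u' \<in> lists {p, m}" "v' \<in> lists {p, m}"
      "balance p m u' = balance p m v'"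
      using split_equal_balance[OF assms(2) w(2,3) eq False] .
    have "u' @ z @ v' \<in> equal_balance_around p m M"
      using s w(4) by (intro equal_balance_aroundI)
    then show ?thesis using letter[of d a "u' @ z @ v'" e] s w(1) by simp
  qed
qed

lemma equal_balance_around_zero:
  assumes "d \<in> zero_words p m" "e \<in> zero_words p m" "z \<in> M"
  shows "d @ z @ e \<in> equal_balance_around p m M"
  using assms by (intro equal_balance_aroundI) (auto simp: zero_words_def)

lemma equal_balance_around_letter:
  assumes "d \<in> zero_words p m" "e \<in> zero_words p m" "y \<in> equal_balance_around p m M"
    "a = p \<or> a = m"
  shows "d @ a # y @ a # e \<in> equal_balance_around p m M"
proof -
  from assms(3) obtain u z v where y: "y = u @ z @ v" "u \<in> lists {p, m}" "v \<in> lists {p, m}"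
    "z \<in> M" "balance p m u = balance p m v"
    unfolding equal_balance_around_def by blast
  have "balance p m (d @ a # u) = balance p m (v @ a # e)"
    using y(5) assms by (simp add: zero_words_def balance_Cons[of p m a u] balance_Cons[of p m a e])
  moreover have "d @ a # u \<in> lists {p, m}" "v @ a # e \<in> lists {p, m}"
    using y assms by (auto simp: zero_words_def)
  ultimately show ?thesis
    using equal_balance_aroundI[of "d @ a # u" p m "v @ a # e" z M] y(1,4) by simp
qed

section \<open>A grammar for the word problem\<close>

text \<open>Nonterminal 1 generates the words of balance \<open>0\<close> and 5 the nonempty ones among them; 2 and 3
  compare balances around \<open>h\<close> and around \<open>t \<dots> h \<dots> t\<close>. The start symbol 0 repeats the rules of 2
  with 5 in place of 1, since neither side of \<open>h\<close> may be empty.\<close>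

definition wp_grammar :: "'t \<Rightarrow> 't \<Rightarrow> 't \<Rightarrow> 't \<Rightarrow> (nat \<times> (nat, 't) symbol list) set" where
  "wp_grammar p m t h = {
     (0, [Nt 5, Tm h, Nt 5]),
     (0, [Nt 1, Tm p, Nt 2, Tm p, Nt 1]),
     (0, [Nt 1, Tm m, Nt 2, Tm m, Nt 1]),
     (0, [Nt 3]),
     (1, []), (1, [Nt 5]),
     (5, [Tm p, Nt 1, Tm m, Nt 1]),
     (5, [Tm m, Nt 1, Tm p, Nt 1]),
     (2, [Nt 1, Tm h, Nt 1]),
     (2, [Nt 1, Tm p, Nt 2, Tm p, Nt 1]),
     (2, [Nt 1, Tm m, Nt 2, Tm m, Nt 1]),
     (3, [Nt 1, Tm t, Nt 4, Tm h, Nt 4, Tm t, Nt 1]),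
     (3, [Nt 1, Tm p, Nt 3, Tm p, Nt 1]),
     (3, [Nt 1, Tm m, Nt 3, Tm m, Nt 1]),
     (4, []), (4, [Tm p, Nt 4]), (4, [Tm m, Nt 4]), (4, [Tm t, Nt 4])}"

text \<open>Here \<open>t\<close> stands for the constant 0 and \<open>h\<close> for the separator.
  Reversal of the second word moves its first \<open>t\<close> to the far right, so such a factor
  reaches from the first \<open>t\<close> of one word to the first \<open>t\<close> of the other;
  what lies between does not affect the values.\<close>

definition zero_marker :: "'t \<Rightarrow> 't \<Rightarrow> 't \<Rightarrow> 't \<Rightarrow> 't list set" where
  "zero_marker p m t h = {[t] @ u @ [h] @ v @ [t] | u v. u \<in> lists {p, m, t} \<and> v \<in> lists {p, m, t}}"

text \<open>Nonemptiness is demanded only in the first part; in the second each side of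
  \<open>h\<close> contains a \<open>t\<close>.\<close>

definition wp_language :: "'t \<Rightarrow> 't \<Rightarrow> 't \<Rightarrow> 't \<Rightarrow> 't list set" where
  "wp_language p m t h =
     {u @ [h] @ v | u v. u \<in> lists {p, m} \<and> v \<in> lists {p, m} \<and> u \<noteq> [] \<and> v \<noteq> [] \<and>
        balance p m u = balance p m v} \<union>
     equal_balance_around p m (zero_marker p m t h)"

text \<open>The guessed solution to which \<open>grammar_language_least\<close> is applied.\<close>

definition wp_nonterminals :: "'t \<Rightarrow> 't \<Rightarrow> 't \<Rightarrow> 't \<Rightarrow> nat \<Rightarrow> 't list set" where
  "wp_nonterminals p m t h = (\<lambda>_. {})(
     0 := wp_language p m t h,
     1 := zero_words p m,
     2 := equal_balance_around p m {[h]},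
     3 := equal_balance_around p m (zero_marker p m t h),
     4 := lists {p, m, t},
     5 := zero_words p m - {[]})"

section \<open>Membership rules and soundness of the grammar\<close>

lemma wp_languageI:
  assumes "u \<in> lists {p, m}" "v \<in> lists {p, m}" "u \<noteq> []" "v \<noteq> []"
    "balance p m u = balance p m v"
  shows "u @ [h] @ v \<in> wp_language p m t h"
  using assms unfolding wp_language_def by blast

lemma wp_language_cases:
  assumes "w \<in> wp_language p m t h"
  obtains (shift) u v where "w = u @ [h] @ v" "u \<in> lists {p, m}" "v \<in> lists {p, m}"
      "u \<noteq> []" "v \<noteq> []" "balance p m u = balance p m v"
  | (const) u s s' v where "w = u @ ([t] @ s @ [h] @ s' @ [t]) @ v"
      "u \<in> lists {p, m}" "v \<in> lists {p, m}" "s \<in> lists {p, m, t}" "s' \<in> lists {p, m, t}"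
      "balance p m u = balance p m v"
  using assms unfolding wp_language_def equal_balance_around_def zero_marker_def by blast

text \<open>The second factor \<open>v\<close> is taken as it stands after the separator, so the
  reversal appears in the equation of values.\<close>

lemma word_problemI:
  assumes "u \<in> lists A" "u \<noteq> []" "v \<in> lists A" "v \<noteq> []"
    "word_value f u = word_value f (rev v)"
  shows "map Some u @ [None] @ map Some v \<in> word_problem f A"
proof -
  have "rev v \<in> lists A" "rev v \<noteq> []"
    using assms(3,4) by (simp_all add: in_lists_conv_set)
  then show ?thesis
    using assms unfolding word_problem_def by (intro CollectI exI[of _ u] exI[of _ "rev v"]) simp
qed

text \<open>The extra letter \<open>a\<close> makes both sides nonempty, which is why the start
  symbol may use nonterminals 1 and 2 in these rules.\<close>

lemma letter_in_wp_language:
  assumes "d \<in> zero_words p m" "e \<in> zero_words p m" "y \<in> equal_balance_around p m {[h]}"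
    "a = p \<or> a = m"
  shows "d @ a # y @ a # e \<in> wp_language p m t h"
proof -
  from assms(3) obtain u v where y: "y = u @ h # v" "u \<in> lists {p, m}" "v \<in> lists {p, m}"
    "balance p m u = balance p m v"
    unfolding equal_balance_around_def by auto
  have "balance p m (d @ a # u) = balance p m (v @ a # e)"
    using y(4) assms by (simp add: zero_words_def balance_Cons[of p m a u] balance_Cons[of p m a e])
  moreover have "d @ a # u \<in> lists {p, m}" "v @ a # e \<in> lists {p, m}"
    using y assms by (auto simp: zero_words_def)
  ultimately show ?thesis
    using y(1) unfolding wp_language_def
    by (intro UnI1 CollectI exI[of _ "d @ a # u"] exI[of _ "v @ a # e"]) simp
qed

lemma wp_nonterminals_closed:
  assumes "p \<noteq> m" "(X, \<alpha>) \<in> wp_grammar p m t h"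
  shows "form_language (wp_nonterminals p m t h) \<alpha> \<subseteq> wp_nonterminals p m t h X"
proof -
  let ?Z = "zero_words p m"
  have five: "u @ h # v \<in> wp_language p m t h" if "u \<in> ?Z" "u \<noteq> []" "v \<in> ?Z" "v \<noteq> []" for u v
    using that by (fastforce simp: wp_language_def zero_words_def)
  have three: "w \<in> wp_language p m t h"
    if "w \<in> equal_balance_around p m (zero_marker p m t h)" for w
    using that by (simp add: wp_language_def)
  have zero: "p # u @ m # v \<in> ?Z" "m # u @ p # v \<in> ?Z" if "u \<in> ?Z" "v \<in> ?Z" for u v
    using that assms(1) by (auto simp: zero_words_def)
  have empty: "[] \<in> ?Z" by (simp add: zero_words_def)
  have marker: "u @ h # v \<in> equal_balance_around p m {[h]}" if "u \<in> ?Z" "v \<in> ?Z" for u v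
    using equal_balance_around_zero[OF that, of "[h]" "{[h]}"] by simp
  have tmarker: "d @ t # u @ h # v @ t # e \<in> equal_balance_around p m (zero_marker p m t h)"
    if "d \<in> ?Z" "e \<in> ?Z" "u \<in> lists {p, m, t}" "v \<in> lists {p, m, t}" for d u v e
  proof -
    have "[t] @ u @ [h] @ v @ [t] \<in> zero_marker p m t h"
      using that(3,4) unfolding zero_marker_def by blast
    from equal_balance_around_zero[OF that(1,2) this] show ?thesis by simp
  qed
  \<comment> \<open>One goal per production. The deleted rules would unfold memberships in
    \<open>lists\<close>, which \<open>tmarker\<close> needs in folded form.\<close>
  show ?thesis
    using assms(2) unfolding wp_grammar_def
    by (elim insertE emptyE; clarsimp simp: wp_nonterminals_def five three zero empty marker tmarker
        letter_in_wp_language equal_balance_around_letter del: in_listsD in_listsI)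
qed

section \<open>Completeness of the grammar\<close>

lemma zero_words_subset_grammar_language:
  assumes "p \<noteq> m"
  shows "zero_words p m \<subseteq> grammar_language (wp_grammar p m t h) 1"
    and "zero_words p m - {[]} \<subseteq> grammar_language (wp_grammar p m t h) 5"
proof -
  let ?G = "grammar_language (wp_grammar p m t h)"
  note closed = grammar_language_closed[where P = "wp_grammar p m t h"]
  have unit: "w \<in> ?G 1" if "w \<in> ?G 5" for w
    by (rule closed[of 1 "[Nt 5]"], simp add: wp_grammar_def) (use that in auto)
  have five: "p # u @ m # v \<in> ?G 5" "m # u @ p # v \<in> ?G 5" if "u \<in> ?G 1" "v \<in> ?G 1" for u v
    by (rule closed[of 5 "[Tm p, Nt 1, Tm m, Nt 1]"], simp add: wp_grammar_def, use that in auto)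
      (rule closed[of 5 "[Tm m, Nt 1, Tm p, Nt 1]"], simp add: wp_grammar_def, use that in auto)
  \<comment> \<open>Both inclusions need a joint induction: the productions of 5 use 1 inside, and
    nonempty words reach 1 through 5.\<close>
  have "w \<in> ?G 1 \<and> (w \<noteq> [] \<longrightarrow> w \<in> ?G 5)" if "w \<in> zero_words p m" for w
    using that assms
  proof (induction rule: zero_words_induct)
    case Nil
    show ?case using closed[of 1 "[]" "[]"] by (simp add: wp_grammar_def)
  qed (use five unit in auto)
  then show "zero_words p m \<subseteq> ?G 1" "zero_words p m - {[]} \<subseteq> ?G 5" by auto
qed

text \<open>Shared by nonterminals 2 and 3: \<open>letters\<close> supplies the two recursive
  productions, \<open>base\<close> covers the words with balance 0 on both sides, and the induction
  peels off one pair of letters at a time.\<close>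

lemma equal_balance_around_subset_grammar_language:
  assumes "p \<noteq> m"
    and letters: "\<And>a. a = p \<or> a = m \<Longrightarrow> (X, [Nt 1, Tm a, Nt X, Tm a, Nt 1]) \<in> wp_grammar p m t h"
    and base: "\<And>d z e. \<lbrakk>d \<in> zero_words p m; z \<in> M; e \<in> zero_words p m\<rbrakk>
      \<Longrightarrow> d @ z @ e \<in> grammar_language (wp_grammar p m t h) X"
  shows "equal_balance_around p m M \<subseteq> grammar_language (wp_grammar p m t h) X"
proof
  let ?G = "grammar_language (wp_grammar p m t h)"
  fix w assume "w \<in> equal_balance_around p m M"
  then show "w \<in> ?G X"
  proof (induction w rule: length_induct)
    case (1 w)
    then have "w \<in> equal_balance_around p m M" by simp
    then show ?case using assms(1)
    proof (cases rule: equal_balance_around_cases)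
      case zero
      then show ?thesis using base by blast
    next
      case (letter a d y e)
      then have "y \<in> ?G X" using 1 by simp
      moreover have "d \<in> ?G 1" "e \<in> ?G 1"
        using letter zero_words_subset_grammar_language(1)[OF assms(1)] by auto
      ultimately show ?thesis
        using letter by (intro grammar_language_closed[OF letters[of a]])
          (auto intro!: form_language_intros simp del: form_language.simps)
    qed
  qed
qed

lemma wp_language_subset_grammar_language:
  assumes "p \<noteq> m"
  shows "wp_language p m t h \<subseteq> grammar_language (wp_grammar p m t h) 0"
proof
  let ?G = "grammar_language (wp_grammar p m t h)"
  note closed = grammar_language_closed[where P = "wp_grammar p m t h"]
  have zero: "w \<in> ?G 1" if "w \<in> zero_words p m" for w
    using zero_words_subset_grammar_language(1)[OF assms] that by blast
  have nonempty: "w \<in> ?G 5" if "w \<in> zero_words p m" "w \<noteq> []" for w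
    using zero_words_subset_grammar_language(2)[OF assms] that by blast
  have all: "w \<in> ?G 4" if "w \<in> lists {p, m, t}" for w
    using that
  proof (induction w)
    case Nil
    show ?case using closed[of 4 "[]" "[]"] by (simp add: wp_grammar_def)
  next
    case (Cons a w)
    from Cons(1) have "(4, [Tm a, Nt 4]) \<in> wp_grammar p m t h"
      by (auto simp: wp_grammar_def)
    then show ?case
      by (rule closed) (use Cons in simp)
  qed
  have two: "equal_balance_around p m {[h]} \<subseteq> ?G 2"
  proof (rule equal_balance_around_subset_grammar_language[OF assms])
    fix d z e assume "d \<in> zero_words p m" "z \<in> {[h]}" "e \<in> zero_words p m"
    then show "d @ z @ e \<in> ?G 2"
      by (intro closed[of 2 "[Nt 1, Tm h, Nt 1]"], simp add: wp_grammar_def)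
        (auto dest!: zero intro!: form_language_intros simp del: form_language.simps)
  qed (auto simp: wp_grammar_def)
  have three: "equal_balance_around p m (zero_marker p m t h) \<subseteq> ?G 3"
  proof (rule equal_balance_around_subset_grammar_language[OF assms])
    fix d z e assume de: "d \<in> zero_words p m" "e \<in> zero_words p m" and "z \<in> zero_marker p m t h"
    then obtain u v where z: "z = [t] @ u @ [h] @ v @ [t]" "u \<in> ?G 4" "v \<in> ?G 4"
      unfolding zero_marker_def using all by blast
    show "d @ z @ e \<in> ?G 3"
    proof (rule closed)
      show "(3, [Nt 1, Tm t, Nt 4, Tm h, Nt 4, Tm t, Nt 1]) \<in> wp_grammar p m t h"
        by (simp add: wp_grammar_def)
      show "d @ z @ e \<in> form_language ?G [Nt 1, Tm t, Nt 4, Tm h, Nt 4, Tm t, Nt 1]"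
        using zero[OF de(1)] zero[OF de(2)] z
        by (auto intro!: form_language_intros simp del: form_language.simps)
    qed
  qed (auto simp: wp_grammar_def)
  fix w assume "w \<in> wp_language p m t h"
  then show "w \<in> ?G 0"
  proof (cases rule: wp_language_cases)
    case (const u s s' v)
    then have "[t] @ s @ [h] @ s' @ [t] \<in> zero_marker p m t h"
      unfolding zero_marker_def by blast
    then have "w \<in> equal_balance_around p m (zero_marker p m t h)"
      unfolding const(1) by (intro equal_balance_aroundI const)
    then show ?thesis
      using three by (intro closed[of 0 "[Nt 3]"], simp add: wp_grammar_def) auto
  next
    case (shift u v)
    show ?thesis
    proof (cases "balance p m u = 0")
      case True
      then have "u \<in> ?G 5" "v \<in> ?G 5"
        using shift by (auto intro!: nonempty simp: zero_words_def)
      then show ?thesis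
        using shift by (intro closed[of 0 "[Nt 5, Tm h, Nt 5]"], simp add: wp_grammar_def)
          (auto intro!: form_language_intros simp del: form_language.simps)
    next
      case False
      \<comment> \<open>One pair of letters is peeled off by a start rule; \<open>u'\<close> and
        \<open>v'\<close> may now be empty, so the inside is left to nonterminal 2.\<close>
      obtain a d u' v' e where s: "a = p \<or> a = m" "u = d @ [a] @ u'" "v = v' @ [a] @ e"
        "d \<in> zero_words p m" "e \<in> zero_words p m" "u' \<in> lists {p, m}" "v' \<in> lists {p, m}"
        "balance p m u' = balance p m v'"
        using split_equal_balance[OF assms shift(2,3,6) False] .
      then have "u' @ [h] @ v' \<in> equal_balance_around p m {[h]}"
        by (intro equal_balance_aroundI) auto
      then obtain y where y: "y = u' @ [h] @ v'" "y \<in> ?G 2" using two by blast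
      from y(2) have "d @ [a] @ y @ [a] @ e \<in> ?G 0"
        using s(1) zero[OF s(4)] zero[OF s(5)]
        by (intro closed[of 0 "[Nt 1, Tm a, Nt 2, Tm a, Nt 1]"], force simp: wp_grammar_def)
          (auto intro!: form_language_intros simp del: form_language.simps)
      then show ?thesis using s shift y(1) by simp
    qed
  qed
qed

lemma context_free_wp_language:
  assumes "p \<noteq> m"
  shows "context_free (wp_language p m t h)"
proof -
  have "grammar_language (wp_grammar p m t h) 0 \<subseteq> wp_nonterminals p m t h 0"
    by (intro grammar_language_least wp_nonterminals_closed assms)
  then have "wp_language p m t h = grammar_language (wp_grammar p m t h) 0"
    using wp_language_subset_grammar_language[OF assms]
    by (auto simp: wp_nonterminals_def)
  moreover have "finite (wp_grammar p m t h)"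
    by (simp add: wp_grammar_def)
  ultimately show ?thesis
    unfolding context_free_def by blast
qed

section \<open>Shifts and constants\<close>

definition shift :: "int \<Rightarrow> int \<Rightarrow> int" where
  "shift k = (\<lambda>i. i + k)"

definition const :: "int \<Rightarrow> int \<Rightarrow> int" where
  "const j = (\<lambda>i. j)"

lemma shift_eq_iff [simp]: "shift k = shift l \<longleftrightarrow> k = l"
  by (auto simp: shift_def fun_eq_iff)

lemma const_eq_iff [simp]: "const k = const l \<longleftrightarrow> k = l"
  by (auto simp: const_def fun_eq_iff)

lemma shift_neq_const [simp]: "shift k \<noteq> const j" "const j \<noteq> shift k"
proof -
  have "shift k 0 \<noteq> shift k 1" "const j 0 = const j 1"
    by (simp_all add: shift_def const_def)
  then show "shift k \<noteq> const j" "const j \<noteq> shift k" by metis+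
qed

lemma comp_shift_const [simp]:
  "shift k \<circ> shift l = shift (k + l)"
  "shift k \<circ> const j = const (k + j)"
  "const j \<circ> f = const j"
  by (auto simp: shift_def const_def)

text \<open>Stated for every \<open>A\<close> in this range because it is used twice: for the
  infinite generating set in the definition and for the three generators of the word problem. The
  other constants arise as \<open>shift j \<circ> const 0\<close>.\<close>

lemma subsemigroup_generated_shift_const:
  assumes sub: "{shift 1, shift (-1), const 0} \<subseteq> A" and sup: "A \<subseteq> range shift \<union> range const"
  shows "subsemigroup_generated (\<circ>) A = range shift \<union> range const"
proof
  have comp: "f \<circ> g \<in> range shift \<union> range const"
    if "f \<in> range shift \<union> range const" "g \<in> range shift \<union> range const" for f g
    using that by auto
  have "f \<in> range shift \<union> range const" if "f \<in> subsemigroup_generated (\<circ>) A" for f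
    using that by induction (use sup comp in blast)+
  then show "subsemigroup_generated (\<circ>) A \<subseteq> range shift \<union> range const" by blast
  define S where "S = subsemigroup_generated (\<circ>) A"
  have gen: "shift 1 \<in> S" "shift (-1) \<in> S" "const 0 \<in> S"
    using sub by (auto simp: S_def intro: subsemigroup_generated.incl)
  have closed: "f \<circ> g \<in> S" if "f \<in> S" "g \<in> S" for f g
    using that unfolding S_def by (rule subsemigroup_generated.mult)
  have shift: "shift k \<in> S" for k
  proof (induction k rule: int_induct[where k = 0])
    case base
    \<comment> \<open>The identity \<open>shift 0\<close> is obtained as
      \<open>shift 1 \<circ> shift (-1)\<close>.\<close>
    show ?case using closed[OF gen(1,2)] by simp
  next
    case (step1 k)
    show ?case using closed[OF gen(1) step1(2)] by (simp add: add.commute)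
  next
    case (step2 k)
    show ?case using closed[OF gen(2) step2(2)] by simp
  qed
  have "const j \<in> S" for j
    using closed[OF shift[of j] gen(3)] by simp
  with shift show "range shift \<union> range const \<subseteq> subsemigroup_generated (\<circ>) A"
    unfolding S_def by blast
qed

lemma shift_const_semigroup_eq: "shift_const_semigroup = range shift \<union> range const"
proof -
  have "{\<lambda>i. i + 1, \<lambda>i. i - 1} \<union> {\<lambda>i. j | j. True} = {shift 1, shift (-1)} \<union> range const"
    by (auto simp: shift_def const_def)
  then show ?thesis
    unfolding shift_const_semigroup_def by (simp only:) (rule subsemigroup_generated_shift_const, auto)
qed

section \<open>Subgroups: complete regularity and the failure of finite covers\<close>

lemma group_shifts: "group (group_structure (\<circ>) (range shift) (shift 0))"
proof (rule groupI)
  fix f assume "f \<in> carrier (group_structure (\<circ>) (range shift) (shift 0))"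
  then obtain k where "f = shift k" by auto
  then show "\<exists>g \<in> carrier (group_structure (\<circ>) (range shift) (shift 0)).
      g \<otimes>\<^bsub>group_structure (\<circ>) (range shift) (shift 0)\<^esub> f = \<one>\<^bsub>group_structure (\<circ>) (range shift) (shift 0)\<^esub>"
    by (intro bexI[of _ "shift (- k)"]) auto
qed (auto simp: comp_assoc add.assoc)

lemma group_const: "group (group_structure (\<circ>) {const j} (const j))"
  by (rule groupI) auto

lemma completely_regular_shift_const: "completely_regular (\<circ>) shift_const_semigroup"
  unfolding completely_regular_def
proof
  show "semigroup_on (\<circ>) shift_const_semigroup"
    unfolding semigroup_on_def shift_const_semigroup_def
    by (auto intro: subsemigroup_generated.mult simp: comp_assoc)
  let ?G = "insert (range shift) (range (\<lambda>j. {const j}))"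
  have "\<forall>G\<in>?G. group_in_semigroup (\<circ>) shift_const_semigroup G"
    using group_shifts group_const
    unfolding group_in_semigroup_def shift_const_semigroup_eq by blast
  moreover have "pairwise disjnt ?G"
    by (auto simp: pairwise_def disjnt_def)
  moreover have "\<Union>?G = shift_const_semigroup"
    by (auto simp: shift_const_semigroup_eq)
  ultimately show "\<exists>\<G>. (\<forall>G\<in>\<G>. group_in_semigroup (\<circ>) shift_const_semigroup G) \<and>
      pairwise disjnt \<G> \<and> \<Union>\<G> = shift_const_semigroup"
    by blast
qed

text \<open>Constants are idempotent, and the only idempotent of a group is its identity.\<close>

lemma group_containing_const:
  assumes "group (group_structure (\<circ>) G e)" "const j \<in> G" "const k \<in> G"
  shows "j = k"
proof -
  interpret group "group_structure (\<circ>) G e" by fact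
  have "const j = e"
    using l_cancel_one[of "const j" "const j"] assms(2) by simp
  moreover have "const k = e"
    using l_cancel_one[of "const k" "const k"] assms(3) by simp
  ultimately show ?thesis by (metis const_eq_iff)
qed

text \<open>Each group accounts for at most one constant, while the constants are indexed by all
  integers.\<close>

lemma shift_const_not_finite_union_of_groups:
  assumes "finite \<G>" "\<And>G. G \<in> \<G> \<Longrightarrow> \<exists>e. group (group_structure (\<circ>) G e)"
  shows "\<Union>\<G> \<noteq> shift_const_semigroup"
proof
  assume "\<Union>\<G> = shift_const_semigroup"
  then have cover: "(UNIV :: int set) = (\<Union>G\<in>\<G>. {j. const j \<in> G})"
    by (auto simp: shift_const_semigroup_eq)
  have "finite {j. const j \<in> G}" if "G \<in> \<G>" for G
  proof (cases "\<exists>j. const j \<in> G")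
    case True
    then obtain j where "const j \<in> G" by blast
    then have "{j. const j \<in> G} \<subseteq> {j}"
      using assms(2)[OF that] group_containing_const by blast
    then show ?thesis by (rule finite_subset) simp
  qed simp
  then have "finite (UNIV :: int set)"
    unfolding cover by (intro finite_UN_I assms(1))
  then show False
    using infinite_UNIV_int by simp
qed

section \<open>The word problem\<close>

lemma word_value_Cons: "w \<noteq> [] \<Longrightarrow> word_value f (a # w) = f a (word_value f w)"
  by (cases w) auto

lemma word_value_shift_word:
  assumes "w \<in> lists {shift 1, shift (-1)}" "w \<noteq> []"
  shows "word_value (\<circ>) w = shift (balance (shift 1) (shift (-1)) w)"
  using assms(2,1)
proof (induction w rule: list_nonempty_induct)
  case (single a)
  then have "a = shift 1 \<or> a = shift (-1)" by simp
  then show "word_value (\<circ>) [a] = shift (balance (shift 1) (shift (-1)) [a])" by auto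
next
  case (cons a w)
  have "word_value (\<circ>) w = shift (balance (shift 1) (shift (-1)) w)"
    by (rule cons.IH) (use cons.prems in simp)
  moreover have "a = shift 1 \<or> a = shift (-1)" using cons.prems by simp
  ultimately show "word_value (\<circ>) (a # w) = shift (balance (shift 1) (shift (-1)) (a # w))"
    using cons.hyps by (auto simp: word_value_Cons add.commute)
qed

text \<open>A constant absorbs whatever is composed on its right, so \<open>v\<close> disappears,
  and the shifts on its left move the value 0 by their exponent sum.\<close>

lemma word_value_const_word:
  assumes "u \<in> lists {shift 1, shift (-1)}"
  shows "word_value (\<circ>) (u @ [const 0] @ v) = const (balance (shift 1) (shift (-1)) u)"
  using assms
proof (induction u)
  case Nil
  show "word_value (\<circ>) ([] @ [const 0] @ v) = const (balance (shift 1) (shift (-1)) [])"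
    by (cases v) simp_all
next
  case (Cons a u)
  have "word_value (\<circ>) (u @ [const 0] @ v) = const (balance (shift 1) (shift (-1)) u)"
    by (rule Cons.IH)
  moreover have "a = shift 1 \<or> a = shift (-1)" using Cons by simp
  ultimately show "word_value (\<circ>) ((a # u) @ [const 0] @ v) =
      const (balance (shift 1) (shift (-1)) (a # u))"
    by (auto simp: word_value_Cons add.commute)
qed

text \<open>The split is made at the first \<open>const 0\<close>, so the prefix consists of shifts
  only.\<close>

lemma shift_const_word_cases:
  assumes "w \<in> lists {shift 1, shift (-1), const 0}"
  obtains (shift) "w \<in> lists {shift 1, shift (-1)}"
  | (const) u v where "w = u @ [const 0] @ v" "u \<in> lists {shift 1, shift (-1)}"
      "v \<in> lists {shift 1, shift (-1), const 0}"
proof (cases "const 0 \<in> set w")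
  case True
  then obtain u v where "w = u @ const 0 # v" "const 0 \<notin> set u"
    by (meson split_list_first)
  then show ?thesis using assms by (intro const[of u v]) (auto simp: in_lists_conv_set)
next
  case False
  then show ?thesis using assms by (intro shift) (auto simp: in_lists_conv_set)
qed

text \<open>Each word evaluates to a shift or a constant determined by one exponent sum, and
  reversal preserves exponent sums. Equal values force both words to be of the same kind, which
  yields the two parts of \<open>wp_language\<close>.\<close>

lemma word_problem_shift_const:
  "word_problem (\<circ>) {shift 1, shift (-1), const 0} =
     wp_language (Some (shift 1)) (Some (shift (-1))) (Some (const 0)) None"
  (is "?WP = ?L")
proof
  let ?A = "{shift 1, shift (-1)}" and ?B = "{shift 1, shift (-1), const 0}"
  let ?SA = "{Some (shift 1), Some (shift (-1))}"
    and ?SB = "{Some (shift 1), Some (shift (-1)), Some (const 0)}"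
  let ?M = "zero_marker (Some (shift 1)) (Some (shift (-1))) (Some (const 0)) None"
  let ?b = "balance (shift 1) (shift (-1))"
    and ?sb = "balance (Some (shift 1)) (Some (shift (-1)))"
  have bal: "?sb (map Some w) = ?b w" for w
    by (rule balance_map_inj) simp
  have lA: "map Some w \<in> lists ?SA" if "w \<in> lists ?A" for w
    using that by (auto simp: in_lists_conv_set)
  have lB: "map Some w \<in> lists ?SB" if "w \<in> lists ?B" for w
    using that by (auto simp: in_lists_conv_set)
  have AB: "w \<in> lists ?B" if "w \<in> lists ?A" for w
    using that by (auto simp: in_lists_conv_set)
  have rA: "rev w \<in> lists ?A" if "w \<in> lists ?A" for w
    using that by (auto simp: in_lists_conv_set)
  have rB: "rev w \<in> lists ?B" if "w \<in> lists ?B" for w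
    using that by (auto simp: in_lists_conv_set)
  have exA: "\<exists>w \<in> lists ?A. x = map Some w" if "x \<in> lists ?SA" for x
    using that lists_image[of Some ?A] by auto
  have exB: "\<exists>w \<in> lists ?B. x = map Some w" if "x \<in> lists ?SB" for x
    using that lists_image[of Some ?B] by auto
  show "?WP \<subseteq> ?L"
  proof
    fix x assume "x \<in> ?WP"
    then obtain u v where x: "x = map Some u @ [None] @ map Some (rev v)"
      and u: "u \<in> lists ?B" "u \<noteq> []" and v: "v \<in> lists ?B" "v \<noteq> []"
      and eq: "word_value (\<circ>) u = word_value (\<circ>) v"
      unfolding word_problem_def by blast
    from u(1) show "x \<in> ?L"
    proof (cases rule: shift_const_word_cases)
      case shift_u: shift
      from v(1) show ?thesis
      proof (cases rule: shift_const_word_cases)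
        case shift
        then have "?b u = ?b v"
          using eq word_value_shift_word[OF shift_u u(2)] word_value_shift_word[OF _ v(2)] by simp
        then have "?sb (map Some u) = ?sb (map Some (rev v))"
          by (simp only: bal balance_simps)
        moreover have "map Some u \<noteq> []" "map Some (rev v) \<noteq> []"
          using u v by simp_all
        ultimately show ?thesis
          unfolding x by (intro wp_languageI lA shift_u rA shift)
      next
        \<comment> \<open>Contradictory: a shift would equal a constant.\<close>
        case (const v1 v2)
        then show ?thesis
          using eq word_value_shift_word[OF shift_u u(2)] word_value_const_word[of v1 v2] by simp
      qed
    next
      case const_u: (const u1 u2)
      from v(1) show ?thesis
      proof (cases rule: shift_const_word_cases)
        case shift
        then show ?thesis
          using const_u eq word_value_shift_word[OF shift v(2)] word_value_const_word[of u1 u2] by simp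
      next
        case (const v1 v2)
        then have "?b u1 = ?b v1"
          using const_u eq word_value_const_word[of u1 u2] word_value_const_word[of v1 v2] by simp
        then have bal_eq: "?sb (map Some u1) = ?sb (map Some (rev v1))"
          by (simp only: bal balance_simps)
        \<comment> \<open>With \<open>u = u1 @ [const 0] @ u2\<close> and
          \<open>v = v1 @ [const 0] @ v2\<close>, this is what remains of the word once
          \<open>u1\<close> and \<open>rev v1\<close> are stripped from its ends.\<close>
        define z where
          "z = [Some (const 0)] @ map Some u2 @ [None] @ map Some (rev v2) @ [Some (const 0)]"
        have "z \<in> ?M"
          unfolding z_def zero_marker_def using lB[OF const_u(3)] lB[OF rB[OF const(3)]] by blast
        then have "map Some u1 @ z @ map Some (rev v1) \<in> ?L"
          unfolding wp_language_def
          by (intro UnI2 equal_balance_aroundI lA const_u(2) rA const(2) bal_eq)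
        then show ?thesis
          unfolding x z_def const(1) const_u(1) by simp
      qed
    qed
  qed
  show "?L \<subseteq> ?WP"
  proof
    fix x assume "x \<in> ?L"
    then show "x \<in> ?WP"
    proof (cases rule: wp_language_cases)
      case (shift u' v')
      obtain u where u: "u \<in> lists ?A" "u' = map Some u" using exA[OF shift(2)] by blast
      obtain v where v: "v \<in> lists ?A" "v' = map Some v" using exA[OF shift(3)] by blast
      have ne: "u \<noteq> []" "v \<noteq> []" using shift u v by simp_all
      have "?b u = ?b (rev v)"
        using shift(6) u(2) v(2) by (simp only: bal balance_simps)
      then have "word_value (\<circ>) u = word_value (\<circ>) (rev v)"
        using word_value_shift_word[OF u(1)] word_value_shift_word[OF rA[OF v(1)]] ne by simp
      then show ?thesis
        unfolding shift(1) u(2) v(2) by (intro word_problemI AB u(1) v(1) ne)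
    next
      case (const u' s' t' v')
      obtain u where u: "u \<in> lists ?A" "u' = map Some u" using exA[OF const(2)] by blast
      obtain v where v: "v \<in> lists ?A" "v' = map Some v" using exA[OF const(3)] by blast
      obtain s where s: "s \<in> lists ?B" "s' = map Some s" using exB[OF const(4)] by blast
      obtain t where t: "t \<in> lists ?B" "t' = map Some t" using exB[OF const(5)] by blast
      \<comment> \<open>Since \<open>rev ?v\<close> is \<open>rev v @ [const 0] @ rev t\<close>, the
        part that determines its value is \<open>rev v\<close>.\<close>
      let ?u = "u @ [const 0] @ s" and ?v = "t @ [const 0] @ v"
      have "?b u = ?b (rev v)"
        using const(6) u(2) v(2) by (simp only: bal balance_simps)
      then have "word_value (\<circ>) ?u = word_value (\<circ>) (rev ?v)"
        using word_value_const_word[OF u(1), of s] word_value_const_word[OF rA[OF v(1)], of "rev t"]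
        by simp
      moreover have "?u \<in> lists ?B" "?v \<in> lists ?B"
        using AB[OF u(1)] AB[OF v(1)] s(1) t(1) by simp_all
      moreover have "x = map Some ?u @ [None] @ map Some ?v"
        using const(1) u(2) v(2) s(2) t(2) by simp
      ultimately show ?thesis
        by (metis word_problemI append_is_Nil_conv list.distinct(1))
    qed
  qed
qed

theorem mainTheorem2:
  shows "completely_regular (\<circ>) shift_const_semigroup
    \<and> has_context_free_word_problem (\<circ>) shift_const_semigroup
    \<and> \<not> (\<exists>\<G>. finite \<G>
           \<and> (\<forall>G\<in>\<G>. fin_gen_group_in_semigroup (\<circ>) shift_const_semigroup G)
           \<and> \<Union>\<G> = shift_const_semigroup)"
proof (intro conjI)
  show "completely_regular (\<circ>) shift_const_semigroup"
    by (rule completely_regular_shift_const)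
  show "has_context_free_word_problem (\<circ>) shift_const_semigroup"
    unfolding has_context_free_word_problem_def
  proof (intro exI conjI)
    show "subsemigroup_generated (\<circ>) {shift 1, shift (-1), const 0} = shift_const_semigroup"
      unfolding shift_const_semigroup_eq by (rule subsemigroup_generated_shift_const) auto
    show "context_free (word_problem (\<circ>) {shift 1, shift (-1), const 0})"
      unfolding word_problem_shift_const by (rule context_free_wp_language) simp
  qed simp
  show "\<not> (\<exists>\<G>. finite \<G>
      \<and> (\<forall>G\<in>\<G>. fin_gen_group_in_semigroup (\<circ>) shift_const_semigroup G)
      \<and> \<Union>\<G> = shift_const_semigroup)"
  proof (intro notI, elim exE conjE)
    fix \<G> :: "(int \<Rightarrow> int) set set"
    assume "finite \<G>" and groups: "\<forall>G\<in>\<G>. fin_gen_group_in_semigroup (\<circ>) shift_const_semigroup G"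
      and union: "\<Union>\<G> = shift_const_semigroup"
    have "\<exists>e. group (group_structure (\<circ>) G e)" if "G \<in> \<G>" for G
      using bspec[OF groups that] unfolding fin_gen_group_in_semigroup_def by (elim conjE exE) (rule exI)
    with shift_const_not_finite_union_of_groups[OF \<open>finite \<G>\<close>] union show False by simp
  qed
qed

end
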